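(* Let $\mathfrak{X}$ be a complex linear space, let $\mathfrak{w}\in\mathcal{F}_+(\mathfrak{X})$ be a fixed form on $\mathfrak{X}$, and consider the partially ordered sets $(\mathcal{F}_+(\mathfrak{X}),\leq^{op})$ and $(\mathcal{F}_+(\mathfrak{X})^{:\mathfrak{w}},\leq)$. Then the pair $(\alpha,\beta)$ of order reversing functions $$\alpha:\mathcal{F}_+(\mathfrak{X})\to\mathcal{F}_+(\mathfrak{X})^{:\mathfrak{w}},\ \alpha(\mathfrak{t})=\mathfrak{t}:\mathfrak{w}\qquad\text{and}\qquad\beta:\mathcal{F}_+(\mathfrak{X})^{:\mathfrak{w}}\to\mathcal{F}_+(\mathfrak{X}),\ \beta(\mathfrak{s})=\mathfrak{s}\div\mathfrak{w}$$ establishes an antitone Galois connection. The set of $(\beta\circ\alpha)$-closed elements is identical with the set of $\mathfrak{w}$-almost dominated forms. Moreover, $\alpha$ is a bijection between $\{\mathbf{D}_{\mathfrak{w}}\mathfrak{t}:\mathfrak{t}\in\mathcal{F}_+(\mathfrak{X})\}$ and $\{\mathfrak{t}:\mathfrak{w}\,\mid\,\mathfrak{t}\in\mathcal{F}_+(\mathfrak{X})\}$, and its inverse is $\beta$.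
   Context: A form on the complex linear space $\mathfrak{X}$ is a nonnegative sesquilinear form $\mathfrak{t}:\mathfrak{X}\times\mathfrak{X}\to\mathbb{C}$ (linear in the first, antilinear in the second variable, $\mathfrak{t}[x]:=\mathfrak{t}(x,x)\geq 0$ for all $x$). $\mathcal{F}_+(\mathfrak{X})$ is the set of all forms on $\mathfrak{X}$, ordered by $\mathfrak{t}\leq\mathfrak{w}$ iff $\mathfrak{t}[x]\leq\mathfrak{w}[x]$ for all $x\in\mathfrak{X}$; $\leq^{op}$ is the opposite order: $\mathfrak{u}\leq^{op}\mathfrak{v}$ iff $\mathfrak{v}\leq\mathfrak{u}$. Parallel sum of forms: $\mathfrak{t}:\mathfrak{w}$ is the form with quadratic form $(\mathfrak{t}:\mathfrak{w})[x]=\inf_{y\in\mathfrak{X}}\{\mathfrak{t}[x-y]+\mathfrak{w}[y]\}$. $\mathcal{F}_+(\mathfrak{X})^{:\mathfrak{w}}=\{\mathfrak{t}:\mathfrak{w}\,\mid\,\mathfrak{t}\in\mathcal{F}_+(\mathfrak{X})\}$. The form $\mathbf{D}_{\mathfrak{w}}\mathfrak{t}:=\sup_{n\in\mathbb{N}}\mathfrak{t}:(n\mathfrak{w})$ is the pointwise limit of the increasing sequence $(\mathfrak{t}:(n\mathfrak{w}))_n$, which is bounded above by $\mathfrak{t}$. Parallel difference: for $\mathfrak{s}\in\mathcal{F}_+(\mathfrak{X})^{:\mathfrak{w}}$, $\mathfrak{s}\div\mathfrak{w}$ is the form with quadratic form $(\mathfrak{s}\div\mathfrak{w})[x]=\sup_{y\in\mathfrak{X}}\{\mathfrak{s}[x+y]-\mathfrak{w}[y]\}$;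 it is known that this supremum is finite for such $\mathfrak{s}$ and defines a form, the minimal solution $\mathfrak{x}\in\mathcal{F}_+(\mathfrak{X})$ of the equation $\mathfrak{x}:\mathfrak{w}=\mathfrak{s}$. A form $\mathfrak{t}$ is $\mathfrak{w}$-dominated if $\mathfrak{t}\leq c\,\mathfrak{w}$ for some constant $c\geq 0$, and $\mathfrak{w}$-almost dominated if $\mathfrak{t}$ is the (order) supremum of some sequence of $\mathfrak{w}$-dominated forms (equivalently, $\mathbf{D}_{\mathfrak{w}}\mathfrak{t}=\mathfrak{t}$). Antitone Galois connection: for partially ordered sets $(U,\sqsubseteq)$ and $(V,\leq)$, order reversing maps $\alpha:U\to V$ and $\beta:V\to U$ establish an antitone Galois connection if, for all $u\in U$ and $v\in V$, $v\leq\alpha(u)$ if and only if $u\sqsubseteq\beta(v)$. An element $u\in U$ is $(\beta\circ\alpha)$-closed if $\beta(\alpha(u))=u$. Here $(U,\sqsubseteq)=(\mathcal{F}_+(\mathfrak{X}),\leq^{op})$ and $(V,\leq)=(\mathcal{F}_+(\mathfrak{X})^{:\mathfrak{w}},\leq)$, and "order reversing" refers to these orders. *)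

theory Defs
  imports "HOL-Analysis.Analysis"
begin

text \<open>
  A complex linear space is a type \<open>'a\<close> with a scalar multiplication \<open>sc\<close> satisfying
  \<open>vector_space sc\<close>.  Antilinearity in the second variable is expressed as linearity of the
  conjugate.
\<close>

definition forms :: "(complex \<Rightarrow> 'a::ab_group_add \<Rightarrow> 'a) \<Rightarrow> ('a \<Rightarrow> 'a \<Rightarrow> complex) set" where
  "forms sc = {t.
     (\<forall>y. Vector_Spaces.linear sc (*) (\<lambda>x. t x y)) \<and>
     (\<forall>x. Vector_Spaces.linear sc (*) (\<lambda>y. cnj (t x y))) \<and>
     (\<forall>x. t x x \<in> \<real>\<^sub>\<ge>\<^sub>0)}"

definition quad :: "('a \<Rightarrow> 'a \<Rightarrow> complex) \<Rightarrow> 'a \<Rightarrow> real" where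
  "quad t x = Re (t x x)"

definition form_le :: "('a \<Rightarrow> 'a \<Rightarrow> complex) \<Rightarrow> ('a \<Rightarrow> 'a \<Rightarrow> complex) \<Rightarrow> bool"
    (infix \<open>\<le>\<^sub>F\<close> 50) where
  "t \<le>\<^sub>F w \<longleftrightarrow> (\<forall>x. quad t x \<le> quad w x)"

definition scale_form :: "real \<Rightarrow> ('a \<Rightarrow> 'a \<Rightarrow> complex) \<Rightarrow> 'a \<Rightarrow> 'a \<Rightarrow> complex" where
  "scale_form c t = (\<lambda>x y. of_real c * t x y)"

text \<open>
  By polarization a form is determined by its quadratic form, so the definite descriptions below
  have at most one candidate.
\<close>

definition parallel_sum ::
    "(complex \<Rightarrow> 'a::ab_group_add \<Rightarrow> 'a) \<Rightarrow> ('a \<Rightarrow> 'a \<Rightarrow> complex) \<Rightarrow> ('a \<Rightarrow> 'a \<Rightarrow> complex)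
      \<Rightarrow> 'a \<Rightarrow> 'a \<Rightarrow> complex" where
  "parallel_sum sc t w =
     (THE s. s \<in> forms sc \<and> (\<forall>x. quad s x = (INF y. quad t (x - y) + quad w y)))"

definition parallel_sums ::
    "(complex \<Rightarrow> 'a::ab_group_add \<Rightarrow> 'a) \<Rightarrow> ('a \<Rightarrow> 'a \<Rightarrow> complex) \<Rightarrow> ('a \<Rightarrow> 'a \<Rightarrow> complex) set" where
  "parallel_sums sc w = {parallel_sum sc t w | t. t \<in> forms sc}"

text \<open>
  The parallel difference is meaningful only for \<open>s \<in> parallel_sums sc w\<close>; for other arguments
  the set of values may be unbounded or the description may be empty.
\<close>

definition parallel_difference ::
    "(complex \<Rightarrow> 'a::ab_group_add \<Rightarrow> 'a) \<Rightarrow> ('a \<Rightarrow> 'a \<Rightarrow> complex) \<Rightarrow> ('a \<Rightarrow> 'a \<Rightarrow> complex)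
      \<Rightarrow> 'a \<Rightarrow> 'a \<Rightarrow> complex" where
  "parallel_difference sc s w =
     (THE u. u \<in> forms sc \<and>
        (\<forall>x. bdd_above (range (\<lambda>y. quad s (x + y) - quad w y)) \<and>
             quad u x = (SUP y. quad s (x + y) - quad w y)))"

definition D_part ::
    "(complex \<Rightarrow> 'a::ab_group_add \<Rightarrow> 'a) \<Rightarrow> ('a \<Rightarrow> 'a \<Rightarrow> complex) \<Rightarrow> ('a \<Rightarrow> 'a \<Rightarrow> complex)
      \<Rightarrow> 'a \<Rightarrow> 'a \<Rightarrow> complex" where
  "D_part sc w t =
     (THE d. d \<in> forms sc \<and>
        (\<forall>x. (\<lambda>n. quad (parallel_sum sc t (scale_form (real n) w)) x) \<longlonglongrightarrow> quad d x))"

definition dominated ::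
    "(complex \<Rightarrow> 'a::ab_group_add \<Rightarrow> 'a) \<Rightarrow> ('a \<Rightarrow> 'a \<Rightarrow> complex) \<Rightarrow> ('a \<Rightarrow> 'a \<Rightarrow> complex) set" where
  "dominated sc w = {t \<in> forms sc. \<exists>c\<ge>0. t \<le>\<^sub>F scale_form c w}"

definition is_form_supremum ::
    "(complex \<Rightarrow> 'a::ab_group_add \<Rightarrow> 'a) \<Rightarrow> ('a \<Rightarrow> 'a \<Rightarrow> complex) set \<Rightarrow> ('a \<Rightarrow> 'a \<Rightarrow> complex) \<Rightarrow> bool" where
  "is_form_supremum sc S t \<longleftrightarrow>
     t \<in> forms sc \<and> (\<forall>s\<in>S. s \<le>\<^sub>F t) \<and>
     (\<forall>u\<in>forms sc. (\<forall>s\<in>S. s \<le>\<^sub>F u) \<longrightarrow> t \<le>\<^sub>F u)"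

definition almost_dominated ::
    "(complex \<Rightarrow> 'a::ab_group_add \<Rightarrow> 'a) \<Rightarrow> ('a \<Rightarrow> 'a \<Rightarrow> complex) \<Rightarrow> ('a \<Rightarrow> 'a \<Rightarrow> complex) set" where
  "almost_dominated sc w = {t \<in> forms sc.
     \<exists>f :: nat \<Rightarrow> 'a \<Rightarrow> 'a \<Rightarrow> complex.
       (\<forall>n. f n \<in> dominated sc w) \<and> is_form_supremum sc (range f) t}"

definition poset_on :: "'u set \<Rightarrow> ('u \<Rightarrow> 'u \<Rightarrow> bool) \<Rightarrow> bool" where
  "poset_on U le \<longleftrightarrow> reflp_on U le \<and> transp_on U le \<and> antisymp_on U le"

text \<open>Order reversing maps are monotone maps into the codomain with the converse order.\<close>

definition antitone_galois_connection ::
    "'u set \<Rightarrow> ('u \<Rightarrow> 'u \<Rightarrow> bool) \<Rightarrow> 'v set \<Rightarrow> ('v \<Rightarrow> 'v \<Rightarrow> bool) \<Rightarrow> ('u \<Rightarrow> 'v) \<Rightarrow> ('v \<Rightarrow> 'u) \<Rightarrow> bool" where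
  "antitone_galois_connection U leU V leV \<alpha> \<beta> \<longleftrightarrow>
     poset_on U leU \<and> poset_on V leV \<and>
     \<alpha> \<in> U \<rightarrow> V \<and> \<beta> \<in> V \<rightarrow> U \<and>
     monotone_on U leU leV\<inverse>\<inverse> \<alpha> \<and> monotone_on V leV leU\<inverse>\<inverse> \<beta> \<and>
     (\<forall>u\<in>U. \<forall>v\<in>V. leV v (\<alpha> u) \<longleftrightarrow> leU u (\<beta> v))"

end

theory Submission
  imports Defs
begin

text \<open>
  By the Jordan--von Neumann theorem both the parallel sum and the parallel difference are forms;
  rearranging \<open>s[x + y] \<le> t[x] + w[y]\<close> gives the Galois connection.  The remaining claims reduce
  to \<open>\<beta> (\<alpha> t) = D\<^sub>w t\<close>.  Here \<open>D\<^sub>w t \<le> \<beta> (\<alpha> t)\<close> holds because every \<open>w\<close>-dominated form \<open>f\<close> is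
  closed: an approximate minimiser \<open>y\<close> of \<open>w[y] - 2 Re f(x, y)\<close> nearly attains the supremum
  defining \<open>\<beta> (\<alpha> f)[x]\<close>.  The converse follows from \<open>n / (n + 1) (t : w) \<le> (t : n w) : w\<close>.
\<close>

section \<open>Order, quadratic forms and polarization\<close>

lemma form_le_refl: "t \<le>\<^sub>F t"
  by (simp add: form_le_def)

lemma form_le_trans: "\<lbrakk>r \<le>\<^sub>F s; s \<le>\<^sub>F t\<rbrakk> \<Longrightarrow> r \<le>\<^sub>F t"
  by (auto simp: form_le_def intro: order_trans)

lemma quad_scale_form: "quad (scale_form c t) x = c * quad t x"
  by (simp add: scale_form_def quad_def)

locale complex_linear_space = vector_space sc
  for sc :: "complex \<Rightarrow> 'a::ab_group_add \<Rightarrow> 'a"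
begin

lemma formsD:
  assumes "t \<in> forms sc"
  shows form_add_left: "t (x + y) z = t x z + t y z"
    and form_scale_left: "t (sc c x) z = c * t x z"
    and form_add_right: "t z (x + y) = t z x + t z y"
    and form_scale_right: "t z (sc c x) = cnj c * t z x"
    and form_diag: "t x x = of_real (quad t x)"
    and quad_nonneg: "0 \<le> quad t x"
proof -
  have l: "Vector_Spaces.linear sc (*) (\<lambda>x. t x z)"
    and r: "Vector_Spaces.linear sc (*) (\<lambda>x. cnj (t z x))"
    and p: "t x x \<in> \<real>\<^sub>\<ge>\<^sub>0"
    using assms by (auto simp: forms_def)
  interpret l: Vector_Spaces.linear sc "(*)" "\<lambda>x. t x z" by (rule l)
  interpret r: Vector_Spaces.linear sc "(*)" "\<lambda>x. cnj (t z x)" by (rule r)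
  show "t (x + y) z = t x z + t y z" "t (sc c x) z = c * t x z"
    by (rule l.add l.scale)+
  have "cnj (t z (x + y)) = cnj (t z x + t z y)" "cnj (t z (sc c x)) = cnj (cnj c * t z x)"
    using r.add r.scale by simp_all
  then show "t z (x + y) = t z x + t z y" "t z (sc c x) = cnj c * t z x"
    by (simp_all only: complex_cnj_cancel_iff)
  show "t x x = of_real (quad t x)" "0 \<le> quad t x"
    using p by (auto simp: quad_def complex_nonneg_Reals_iff complex_eq_iff)
qed

lemma quad_add_scale:
  assumes "t \<in> forms sc"
  shows "quad t (x + sc (of_real r) y)
    = quad t x + r * (Re (t x y) + Re (t y x)) + r\<^sup>2 * quad t y"
  by (simp add: quad_def form_add_left[OF assms] form_add_right[OF assms]
      form_scale_left[OF assms] form_scale_right[OF assms] algebra_simps power2_eq_square)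

lemma quad_add:
  assumes "t \<in> forms sc"
  shows "quad t (x + y) = quad t x + (Re (t x y) + Re (t y x)) + quad t y"
  using quad_add_scale[OF assms, of x 1 y] by simp

lemma quad_diff:
  assumes "t \<in> forms sc"
  shows "quad t (x - y) = quad t x - (Re (t x y) + Re (t y x)) + quad t y"
  using quad_add_scale[OF assms, of x "-1" y] by simp

lemma quad_scale:
  assumes "t \<in> forms sc"
  shows "quad t (sc c x) = (cmod c)\<^sup>2 * quad t x"
proof -
  have "t (sc c x) (sc c x) = of_real ((cmod c)\<^sup>2 * quad t x)"
    by (simp only: form_scale_left[OF assms] form_scale_right[OF assms] form_diag[OF assms, of x]
        of_real_mult complex_norm_square mult_ac)
  then show ?thesis
    unfolding quad_def by simp
qed

lemma quad_zero: "t \<in> forms sc \<Longrightarrow> quad t 0 = 0"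
  using quad_scale[of t 0 0] by simp

lemma parallelogram:
  assumes "t \<in> forms sc"
  shows "quad t (x + y) + quad t (x - y) = 2 * quad t x + 2 * quad t y"
  by (simp add: quad_add[OF assms] quad_diff[OF assms])

lemma form_polarization:
  assumes "t \<in> forms sc"
  shows "4 * t x y = of_real (quad t (x + y)) - of_real (quad t (x + sc (-1) y))
    + \<i> * of_real (quad t (x + sc \<i> y)) - \<i> * of_real (quad t (x + sc (-\<i>) y))"
  unfolding form_diag[OF assms, symmetric] form_add_left[OF assms] form_add_right[OF assms]
    form_scale_left[OF assms] form_scale_right[OF assms]
  by (simp add: algebra_simps)

lemma form_eqI:
  assumes "s \<in> forms sc" "t \<in> forms sc" "\<And>x. quad s x = quad t x"
  shows "s = t"
proof (intro ext)
  fix x y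
  have "4 * s x y = 4 * t x y"
    by (simp only: form_polarization[OF assms(1)] form_polarization[OF assms(2)] assms(3))
  then show "s x y = t x y" by simp
qed

lemma scale_form_form:
  assumes "0 \<le> c" "t \<in> forms sc"
  shows "scale_form c t \<in> forms sc"
proof -
  have "Vector_Spaces.linear sc (*) (\<lambda>x. scale_form c t x y)"
    "Vector_Spaces.linear sc (*) (\<lambda>x. cnj (scale_form c t y x))" for y
    by unfold_locales (simp_all add: scale_form_def form_add_left[OF assms(2)]
        form_add_right[OF assms(2)] form_scale_left[OF assms(2)] form_scale_right[OF assms(2)]
        algebra_simps)
  moreover have "scale_form c t x x \<in> \<real>\<^sub>\<ge>\<^sub>0" for x
    using assms quad_nonneg[OF assms(2), of x]
    by (simp add: scale_form_def form_diag[OF assms(2)] flip: of_real_mult)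
  ultimately show ?thesis by (simp add: forms_def)
qed

lemma form_le_antisym:
  "\<lbrakk>s \<in> forms sc; t \<in> forms sc; s \<le>\<^sub>F t; t \<le>\<^sub>F s\<rbrakk> \<Longrightarrow> s = t"
  by (intro form_eqI) (auto simp: form_le_def intro: order.antisym)

end

section \<open>From the parallelogram law to a form (Jordan--von Neumann)\<close>

text \<open>Splitting \<open>n r\<close> into its floor and a remainder \<open>d\<close> in the unit
  interval, additivity turns \<open>n (f r - r f 1)\<close> into \<open>f d - d f 1\<close>. This is
  bounded uniformly in \<open>n\<close>, so the Archimedean property forces
  \<open>f r = r f 1\<close>. It supplies real homogeneity in the Jordan--von Neumann
  theorem.\<close>

lemma additive_bounded_imp_linear:
  fixes f :: "real \<Rightarrow> real"
  assumes add: "\<And>a b. f (a + b) = f a + f b"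
    and bounded: "\<And>a. \<lbrakk>0 \<le> a; a \<le> 1\<rbrakk> \<Longrightarrow> \<bar>f a\<bar> \<le> C"
  shows "f r = r * f 1"
proof -
  interpret additive f by unfold_locales (rule add)
  have nat_mult: "f (real n * a) = real n * f a" for n a
    by (induction n) (simp_all add: zero add distrib_right)
  have int_mult: "f (real_of_int k) = real_of_int k * f 1" for k
    using nat_mult[of _ 1] minus[of "real _"] by (cases k) (simp_all add: minus del: of_nat_Suc)
  have "real n * \<bar>f r - r * f 1\<bar> \<le> C + \<bar>f 1\<bar>" for n
  proof -
    define m where "m = \<lfloor>real n * r\<rfloor>"
    define d where "d = real n * r - of_int m"
    have d: "0 \<le> d" "d \<le> 1" unfolding d_def m_def by linarith+
    have "real n * f r = of_int m * f 1 + f d"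
      using add[of "of_int m" d] by (simp add: nat_mult int_mult d_def)
    then have "real n * (f r - r * f 1) = f d - d * f 1"
      by (simp add: d_def algebra_simps)
    then have "real n * \<bar>f r - r * f 1\<bar> = \<bar>f d - d * f 1\<bar>"
      by (metis abs_mult abs_of_nat)
    also have "\<dots> \<le> \<bar>f d\<bar> + d * \<bar>f 1\<bar>"
      using abs_triangle_ineq4[of "f d" "d * f 1"] d by (simp add: abs_mult)
    also have "\<dots> \<le> C + \<bar>f 1\<bar>"
      using bounded[OF d] d by (intro add_mono mult_left_le_one_le) auto
    finally show ?thesis .
  qed
  then have "\<not> 0 < \<bar>f r - r * f 1\<bar>"
    using reals_Archimedean3 by (meson linorder_not_less)
  then show ?thesis by simp
qed

context complex_linear_space
begin

text \<open>Applying the inequality to \<open>x + y\<close> and \<open>x - y\<close>, whose sum and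
  difference are \<open>2 x\<close> and \<open>2 y\<close>, gives the reverse inequality, because
  \<open>q\<close> picks up the factor 4. An infimum or supremum thus has to satisfy only one half
  of the law.\<close>

lemma parallelogram_of_le:
  assumes scale: "\<And>c x. q (sc c x) = (cmod c)\<^sup>2 * q x"
    and le: "\<And>x y. q (x + y) + q (x - y) \<le> 2 * q x + 2 * q y"
  shows "q (x + y) + q (x - y) = 2 * q x + (2 * q y :: real)"
proof -
  have "x + y + (x - y) = sc 2 x" "x + y - (x - y) = sc 2 y"
    using scale_left_distrib[of 1 1] by simp_all
  then have "4 * q x + 4 * q y \<le> 2 * q (x + y) + 2 * q (x - y)"
    using le[of "x + y" "x - y"] scale[of 2] by simp
  with le[of x y] show ?thesis by simp
qed

lemma parallelogram_of_ge:
  assumes scale: "\<And>c x. q (sc c x) = (cmod c)\<^sup>2 * q x"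
    and ge: "\<And>x y. 2 * q x + 2 * q y \<le> q (x + y) + q (x - y)"
  shows "q (x + y) + q (x - y) = 2 * q x + (2 * q y :: real)"
  using parallelogram_of_le[of "\<lambda>x. - q x" x y] scale ge by (simp add: field_simps)

theorem Jordan_von_Neumann:
  assumes nonneg: "\<And>x. 0 \<le> q x"
    and scale: "\<And>c x. q (sc c x) = (cmod c)\<^sup>2 * q x"
    and para: "\<And>x y. q (x + y) + q (x - y) = 2 * q x + 2 * q y"
  shows "\<exists>s\<in>forms sc. \<forall>x. quad s x = q x"
proof -
  define R where "R x y = (q (x + y) - q (x - y)) / 4" for x y
  \<comment> \<open>\<open>R\<close> is the real part of the form to be built. Antilinearity in the
    second variable dictates the imaginary part: \<open>Im (s x y)\<close> is the real part of
    \<open>s x (\<i> y)\<close>.\<close>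
  define s where "s x y = Complex (R x y) (R x (sc \<i> y))" for x y
  have q0: "q 0 = 0" using scale[of 0 0] by simp
  have q_minus: "q (- x) = q x" for x using scale[of "-1" x] by simp
  have q_minus': "q (x - y) = q (y - x)" for x y using q_minus[of "x - y"] by simp
  have q_ii: "q (sc \<i> x) = q x" for x using scale[of \<i> x] by simp
  have R_sym: "R x y = R y x" for x y by (simp add: R_def add.commute q_minus')
  \<comment> \<open>Subtracting the two parallelogram identities cancels \<open>q (x - z)\<close>.
    The doubled second argument \<open>y + y\<close> disappears in \<open>R_add\<close> by
    comparison with the case of a zero summand.\<close>
  have R_sum: "R x y + R z y = R (x + z) (y + y) / 2" for x y z
    using para[of "x + y" "z + y"] para[of "x - y" "z - y"]
    by (simp add: R_def field_simps)
  have R_0: "R 0 y = 0" for y by (simp add: R_def q_minus)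
  have R_add: "R (x + z) y = R x y + R z y" for x y z
    using R_sum[of "x + z" y 0] R_sum[of x y z] by (simp add: R_0)
  have R_minus: "R (- x) y = - R x y" for x y
    using R_add[of "- x" x y] by (simp add: R_0)
  have R_ii: "R (sc \<i> x) (sc \<i> y) = R x y" for x y
    by (simp add: R_def q_ii flip: scale_right_distrib scale_right_diff_distrib)
  have R_ii_left: "R (sc \<i> x) y = - R x (sc \<i> y)" for x y
    using R_ii[of "sc \<i> x" y] by (simp add: R_minus)
  \<comment> \<open>Both \<open>q (x + y)\<close> and \<open>q (x - y)\<close> lie between 0 and
    \<open>2 q x + 2 q y\<close>. Since \<open>q (a x) \<le> q x\<close> for real \<open>a\<close>
    in the unit interval, the bound is uniform along that segment, as needed for real
    homogeneity.\<close>
  have R_bound: "\<bar>R x y\<bar> \<le> (q x + q y) / 2" for x y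
    using para[of x y] nonneg[of "x + y"] nonneg[of "x - y"] unfolding R_def
    by (simp add: abs_le_iff field_simps)
  have R_scale: "R (sc (of_real r) x) y = r * R x y" for r x y
  proof -
    have "\<bar>R (sc (of_real a) x) y\<bar> \<le> (q x + q y) / 2" if "0 \<le> a" "a \<le> 1" for a
    proof -
      have "a\<^sup>2 * q x \<le> q x"
        using that nonneg[of x] by (simp add: mult_left_le_one_le power_le_one)
      with R_bound[of "sc (of_real a) x" y] show ?thesis by (simp add: scale)
    qed
    then have "R (sc (of_real r) x) y = r * R (sc (of_real 1) x) y"
      by (intro additive_bounded_imp_linear[of _ "(q x + q y) / 2"])
        (simp_all only: scale_left_distrib R_add of_real_add)
    then show ?thesis by simp
  qed
  have s_add: "s (x + z) y = s x y + s z y" for x y z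
    by (simp add: s_def R_add complex_eq_iff)
  have s_ii: "s (sc \<i> x) y = \<i> * s x y" for x y
    unfolding s_def R_ii by (simp add: complex_eq_iff R_ii_left)
  have s_real: "s (sc (of_real r) x) y = r * s x y" for r x y
    by (simp add: s_def complex_eq_iff R_scale)
  have s_scale: "s (sc c x) y = c * s x y" for c x y
  proof -
    have "sc c x = sc (of_real (Re c) + \<i> * of_real (Im c)) x"
      by (simp only: complex_eq[symmetric])
    also have "\<dots> = sc (of_real (Re c)) x + sc \<i> (sc (of_real (Im c)) x)"
      by (simp add: scale_left_distrib)
    finally have "s (sc c x) y = (of_real (Re c) + \<i> * of_real (Im c)) * s x y"
      by (simp only: s_add s_ii s_real distrib_right mult.assoc)
    then show ?thesis by (simp only: complex_eq[symmetric])
  qed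
  \<comment> \<open>Hermitian symmetry turns linearity in the first variable into linearity of the
    conjugate in the second.\<close>
  have s_herm: "cnj (s x y) = s y x" for x y
    by (simp add: s_def complex_eq_iff R_sym[of y x] R_sym[of y "sc \<i> x"] R_ii_left)
  have s_diag: "s x x = of_real (q x)" for x
  proof -
    have "x + x = sc 2 x" using scale_left_distrib[of 1 1 x] by simp
    then have "R x x = q x" using scale[of 2 x] by (simp add: R_def q0)
    moreover have "R x (sc \<i> x) = 0"
      using R_ii_left[of x x] R_sym[of x "sc \<i> x"] by simp
    ultimately show ?thesis by (simp add: s_def complex_eq_iff)
  qed
  have lin: "Vector_Spaces.linear sc (*) (\<lambda>x. s x y)" for y
    by unfold_locales (simp_all add: s_add s_scale algebra_simps)
  have "s \<in> forms sc"
    using lin nonneg by (simp add: forms_def s_herm s_diag)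
  then show ?thesis
    by (intro bexI[of _ s]) (simp_all add: quad_def s_diag)
qed

section \<open>The parallel sum as a form\<close>

lemma parallel_sum_bdd_below:
  assumes "t \<in> forms sc" "w \<in> forms sc"
  shows "bdd_below (range (\<lambda>y. quad t (x - y) + quad w y))"
  by (rule bdd_belowI2[of _ 0]) (simp add: quad_nonneg assms)

text \<open>The infimum inherits homogeneity and the parallelogram law from \<open>t\<close> and
  \<open>w\<close> as inequalities, and each inequality improves to an equality. Jordan--von Neumann
  and polarization then make the definite description well defined.\<close>

lemma parallel_sum_spec:
  assumes t: "t \<in> forms sc" and w: "w \<in> forms sc"
  shows "parallel_sum sc t w \<in> forms sc \<and>
    (\<forall>x. quad (parallel_sum sc t w) x = (INF y. quad t (x - y) + quad w y))"
proof -
  define q where "q x = (INF y. quad t (x - y) + quad w y)" for x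
  have lower: "q x \<le> quad t (x - y) + quad w y" for x y
    unfolding q_def by (rule cINF_lower[OF parallel_sum_bdd_below[OF t w] UNIV_I])
  have greatest: "c \<le> q x" if "\<And>y. c \<le> quad t (x - y) + quad w y" for c x
    unfolding q_def using that by (intro cINF_greatest) auto
  have nonneg: "0 \<le> q x" for x
    by (rule greatest) (simp add: quad_nonneg t w)
  have scale_le: "q (sc c x) \<le> (cmod c)\<^sup>2 * q x" for c x
  proof (cases "c = 0")
    case True
    then show ?thesis using lower[of 0 0] by (simp add: quad_zero t w)
  next
    case False
    have "q (sc c x) / (cmod c)\<^sup>2 \<le> q x"
    proof (rule greatest)
      fix y
      have "q (sc c x) \<le> (cmod c)\<^sup>2 * (quad t (x - y) + quad w y)"
        using lower[of "sc c x" "sc c y"]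
        by (simp add: quad_scale t w distrib_left flip: scale_right_diff_distrib)
      then show "q (sc c x) / (cmod c)\<^sup>2 \<le> quad t (x - y) + quad w y"
        using False by (simp add: pos_divide_le_eq mult.commute)
    qed
    then show ?thesis using False by (simp add: pos_divide_le_eq mult.commute)
  qed
  have scale: "q (sc c x) = (cmod c)\<^sup>2 * q x" for c x
  proof (cases "c = 0")
    case True
    then show ?thesis using scale_le[of c x] nonneg[of "sc c x"] by simp
  next
    case False
    \<comment> \<open>The reverse inequality is \<open>scale_le\<close> itself, applied to the
      inverse scalar.\<close>
    then have "q x \<le> (1 / cmod c)\<^sup>2 * q (sc c x)"
      using scale_le[of "1 / c" "sc c x"] by (simp add: norm_divide)
    then have "(cmod c)\<^sup>2 * q x \<le> q (sc c x)"
      using False by (simp add: power_divide pos_le_divide_eq mult.commute)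
    with scale_le[of c x] show ?thesis by simp
  qed
  have "q (x + z) + q (x - z) \<le> 2 * q x + 2 * q z" for x z
  proof -
    \<comment> \<open>Splitting \<open>x + z\<close> at \<open>y + v\<close> and
      \<open>x - z\<close> at \<open>y - v\<close> lets the parallelogram laws of \<open>t\<close>
      and \<open>w\<close> apply to the four terms.\<close>
    have ineq: "q (x + z) + q (x - z)
      \<le> 2 * (quad t (x - y) + quad w y) + 2 * (quad t (z - v) + quad w v)" for y v
      using lower[of "x + z" "y + v"] lower[of "x - z" "y - v"]
        parallelogram[OF t, of "x - y" "z - v"] parallelogram[OF w, of y v]
      by (simp add: algebra_simps)
    \<comment> \<open>The infima are taken one after the other: over \<open>v\<close> with
      \<open>y\<close> fixed, then over \<open>y\<close>.\<close>
    have "(q (x + z) + q (x - z)) / 2 - (quad t (x - y) + quad w y) \<le> q z" for y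
      by (rule greatest) (use ineq[of y] in \<open>simp add: field_simps\<close>)
    then have "(q (x + z) + q (x - z)) / 2 - q z \<le> quad t (x - y) + quad w y" for y
      by (smt (verit))
    then have "(q (x + z) + q (x - z)) / 2 - q z \<le> q x"
      by (rule greatest)
    then show ?thesis by (simp add: field_simps)
  qed
  from parallelogram_of_le[OF scale this]
  have "\<exists>s\<in>forms sc. \<forall>x. quad s x = q x"
    by (intro Jordan_von_Neumann nonneg scale)
  then have "\<exists>!s. s \<in> forms sc \<and> (\<forall>x. quad s x = q x)"
    by (auto intro: form_eqI)
  from theI'[OF this] show ?thesis
    by (simp add: parallel_sum_def q_def)
qed

lemmas parallel_sum_form = parallel_sum_spec[THEN conjunct1]
lemmas quad_parallel_sum = parallel_sum_spec[THEN conjunct2, rule_format]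

lemma le_quad_parallel_sum_iff:
  assumes "t \<in> forms sc" "w \<in> forms sc"
  shows "c \<le> quad (parallel_sum sc t w) x \<longleftrightarrow> (\<forall>y. c \<le> quad t (x - y) + quad w y)"
  by (simp add: quad_parallel_sum le_cINF_iff parallel_sum_bdd_below assms)

lemma quad_parallel_sum_add_le:
  assumes "t \<in> forms sc" "w \<in> forms sc"
  shows "quad (parallel_sum sc t w) (x + y) \<le> quad t x + quad w y"
  using le_quad_parallel_sum_iff[OF assms, of _ "x + y"] by (metis add_diff_cancel_right' order_refl)

lemma parallel_sum_le_left:
  assumes "t \<in> forms sc" "w \<in> forms sc"
  shows "parallel_sum sc t w \<le>\<^sub>F t"
  using quad_parallel_sum_add_le[OF assms, of _ 0] by (simp add: form_le_def quad_zero assms)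

lemma parallel_sum_le_right:
  assumes "t \<in> forms sc" "w \<in> forms sc"
  shows "parallel_sum sc t w \<le>\<^sub>F w"
  using quad_parallel_sum_add_le[OF assms, of 0] by (simp add: form_le_def quad_zero assms)

lemma parallel_sum_mono_left:
  assumes "s \<in> forms sc" "t \<in> forms sc" "w \<in> forms sc" "s \<le>\<^sub>F t"
  shows "parallel_sum sc s w \<le>\<^sub>F parallel_sum sc t w"
proof -
  have "quad (parallel_sum sc s w) x \<le> quad t (x - y) + quad w y" for x y
    using quad_parallel_sum_add_le[OF assms(1,3), of "x - y" y] assms(4)
    by (auto simp: form_le_def intro: order_trans)
  then show ?thesis
    by (simp add: form_le_def le_quad_parallel_sum_iff assms)
qed

section \<open>The parallel difference and its adjunction with the parallel sum\<close>

text \<open>The argument is dual to that for the parallel sum, with suprema and reversed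
  inequalities. The representation \<open>s = t : w\<close> provides finiteness, through the upper
  bound \<open>t[x]\<close>, and the vanishing of the supremum at the origin, through
  \<open>s \<le> w\<close>.\<close>

lemma parallel_difference_spec:
  assumes t: "t \<in> forms sc" and w: "w \<in> forms sc" and s: "s = parallel_sum sc t w"
  shows "parallel_difference sc s w \<in> forms sc \<and>
    (\<forall>x. bdd_above (range (\<lambda>y. quad s (x + y) - quad w y)) \<and>
      quad (parallel_difference sc s w) x = (SUP y. quad s (x + y) - quad w y))"
proof -
  have sf: "s \<in> forms sc" by (simp add: s parallel_sum_form t w)
  have bdd: "bdd_above (range (\<lambda>y. quad s (x + y) - quad w y))" for x
    using quad_parallel_sum_add_le[OF t w, folded s]
    by (intro bdd_aboveI2[of _ _ "quad t x"]) (simp add: diff_le_eq)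
  define q where "q x = (SUP y. quad s (x + y) - quad w y)" for x
  have upper: "quad s (x + y) - quad w y \<le> q x" for x y
    unfolding q_def by (rule cSUP_upper[OF UNIV_I bdd])
  have least: "q x \<le> c" if "\<And>y. quad s (x + y) - quad w y \<le> c" for c x
    unfolding q_def using that by (intro cSUP_least) auto
  have nonneg: "0 \<le> q x" for x
    using upper[of x 0] quad_nonneg[OF sf, of x] by (simp add: quad_zero w)
  have scale_ge: "(cmod c)\<^sup>2 * q x \<le> q (sc c x)" for c x
  proof (cases "c = 0")
    case True
    then show ?thesis by (simp add: nonneg)
  next
    case False
    have "q x \<le> q (sc c x) / (cmod c)\<^sup>2"
    proof (rule least)
      fix y
      have "(cmod c)\<^sup>2 * (quad s (x + y) - quad w y) \<le> q (sc c x)"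
        using upper[of "sc c x" "sc c y"]
        by (simp add: quad_scale sf w right_diff_distrib flip: scale_right_distrib)
      then show "quad s (x + y) - quad w y \<le> q (sc c x) / (cmod c)\<^sup>2"
        using False by (simp add: pos_le_divide_eq mult.commute)
    qed
    then show ?thesis using False by (simp add: pos_le_divide_eq mult.commute)
  qed
  \<comment> \<open>For scalar 0 there is no inverse to apply; the case reduces to
    \<open>s[y] - w[y] \<le> 0\<close>.\<close>
  have q0: "q 0 \<le> 0"
    by (rule least) (use parallel_sum_le_right[OF t w, folded s] in \<open>simp add: form_le_def\<close>)
  have scale: "q (sc c x) = (cmod c)\<^sup>2 * q x" for c x
  proof (cases "c = 0")
    case True
    then show ?thesis using q0 nonneg[of 0] by simp
  next
    case False
    then have "(1 / cmod c)\<^sup>2 * q (sc c x) \<le> q x"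
      using scale_ge[of "1 / c" "sc c x"] by (simp add: norm_divide)
    then have "q (sc c x) \<le> (cmod c)\<^sup>2 * q x"
      using False by (simp add: power_divide pos_divide_le_eq mult.commute)
    with scale_ge[of c x] show ?thesis by simp
  qed
  have "2 * q x + 2 * q z \<le> q (x + z) + q (x - z)" for x z
  proof -
    have ineq: "2 * (quad s (x + y) - quad w y) + 2 * (quad s (z + v) - quad w v)
      \<le> q (x + z) + q (x - z)" for y v
      using upper[of "x + z" "y + v"] upper[of "x - z" "y - v"]
        parallelogram[OF sf, of "x + y" "z + v"] parallelogram[OF w, of y v]
      by (simp add: algebra_simps)
    have "q z \<le> (q (x + z) + q (x - z)) / 2 - (quad s (x + y) - quad w y)" for y
      by (rule least) (use ineq[of y] in \<open>simp add: field_simps\<close>)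
    then have "quad s (x + y) - quad w y \<le> (q (x + z) + q (x - z)) / 2 - q z" for y
      by (smt (verit))
    then have "q x \<le> (q (x + z) + q (x - z)) / 2 - q z"
      by (rule least)
    then show ?thesis by (simp add: field_simps)
  qed
  from parallelogram_of_ge[OF scale this]
  have "\<exists>u\<in>forms sc. \<forall>x. quad u x = q x"
    by (intro Jordan_von_Neumann nonneg scale)
  then have "\<exists>!u. u \<in> forms sc \<and>
      (\<forall>x. bdd_above (range (\<lambda>y. quad s (x + y) - quad w y)) \<and> quad u x = q x)"
    using bdd by (auto intro: form_eqI)
  from theI'[OF this] show ?thesis
    unfolding parallel_difference_def q_def .
qed

lemma parallel_difference_form:
  assumes "w \<in> forms sc" "s \<in> parallel_sums sc w"
  shows "parallel_difference sc s w \<in> forms sc"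
  using assms parallel_difference_spec by (auto simp: parallel_sums_def)

lemma quad_parallel_difference_le_iff:
  assumes "w \<in> forms sc" "s \<in> parallel_sums sc w"
  shows "quad (parallel_difference sc s w) x \<le> c \<longleftrightarrow> (\<forall>y. quad s (x + y) - quad w y \<le> c)"
proof -
  obtain t where "t \<in> forms sc" "s = parallel_sum sc t w"
    using assms by (auto simp: parallel_sums_def)
  from parallel_difference_spec[OF this(1) assms(1) this(2)] show ?thesis
    by (simp add: cSUP_le_iff)
qed

lemma le_parallel_sum_iff:
  assumes t: "t \<in> forms sc" and w: "w \<in> forms sc" and s: "s \<in> parallel_sums sc w"
  shows "s \<le>\<^sub>F parallel_sum sc t w \<longleftrightarrow> parallel_difference sc s w \<le>\<^sub>F t"
proof -
  have "s \<le>\<^sub>F parallel_sum sc t w \<longleftrightarrow> (\<forall>x y. quad s x \<le> quad t (x - y) + quad w y)"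
    by (simp add: form_le_def le_quad_parallel_sum_iff t w)
  \<comment> \<open>For each fixed \<open>y\<close>, translation by \<open>y\<close> is a bijective
    change of the variable \<open>x\<close>.\<close>
  also have "\<dots> \<longleftrightarrow> (\<forall>x y. quad s (x + y) \<le> quad t x + quad w y)"
    by (metis add_diff_cancel_right' diff_add_cancel)
  also have "\<dots> \<longleftrightarrow> parallel_difference sc s w \<le>\<^sub>F t"
    by (simp add: form_le_def quad_parallel_difference_le_iff w s diff_le_eq)
  finally show ?thesis .
qed

end

section \<open>The connection and its closure operator for a fixed \<open>w\<close>\<close>

locale form_space = complex_linear_space sc
  for sc :: "complex \<Rightarrow> 'a::ab_group_add \<Rightarrow> 'a" +
  fixes w :: "'a \<Rightarrow> 'a \<Rightarrow> complex"
  assumes w: "w \<in> forms sc"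
begin

abbreviation \<alpha> where "\<alpha> t \<equiv> parallel_sum sc t w"
abbreviation \<beta> where "\<beta> s \<equiv> parallel_difference sc s w"

lemma parallel_sums_forms: "s \<in> parallel_sums sc w \<Longrightarrow> s \<in> forms sc"
  by (auto simp: parallel_sums_def parallel_sum_form w)

lemma parallel_sum_in: "t \<in> forms sc \<Longrightarrow> \<alpha> t \<in> parallel_sums sc w"
  by (auto simp: parallel_sums_def)

lemma closure_form: "t \<in> forms sc \<Longrightarrow> \<beta> (\<alpha> t) \<in> forms sc"
  by (simp add: parallel_difference_form w parallel_sum_in)

text \<open>This is reflexivity at \<open>\<alpha> t\<close>, carried across the adjunction.\<close>

lemma closure_le: "t \<in> forms sc \<Longrightarrow> \<beta> (\<alpha> t) \<le>\<^sub>F t"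
  by (subst le_parallel_sum_iff[symmetric]) (simp_all add: w parallel_sum_in form_le_def)

lemma closure_mono:
  assumes "s \<in> forms sc" "t \<in> forms sc" "s \<le>\<^sub>F t"
  shows "\<beta> (\<alpha> s) \<le>\<^sub>F \<beta> (\<alpha> t)"
proof -
  have "\<alpha> t \<le>\<^sub>F \<alpha> (\<beta> (\<alpha> t))"
    by (simp add: le_parallel_sum_iff w parallel_sum_in closure_form assms) (simp add: form_le_def)
  with parallel_sum_mono_left[OF assms(1,2) w assms(3)] have "\<alpha> s \<le>\<^sub>F \<alpha> (\<beta> (\<alpha> t))"
    by (auto simp: form_le_def intro: order_trans)
  then show ?thesis
    by (simp add: le_parallel_sum_iff w parallel_sum_in closure_form assms)
qed

text \<open>One inequality is reflexivity at \<open>\<beta> s\<close>, carried across the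
  adjunction. For the other, write \<open>s = \<alpha> t\<close> and apply the monotone
  \<open>\<alpha>\<close> to \<open>\<beta> (\<alpha> t) \<le> t\<close>. Hence
  \<open>\<beta>\<close> is a right inverse of \<open>\<alpha>\<close>, on which the final bijection
  rests.\<close>

lemma parallel_sum_parallel_difference:
  assumes "s \<in> parallel_sums sc w"
  shows "\<alpha> (\<beta> s) = s"
proof -
  obtain t where t: "t \<in> forms sc" "s = \<alpha> t" using assms by (auto simp: parallel_sums_def)
  have "s \<le>\<^sub>F \<alpha> (\<beta> s)"
    by (simp add: le_parallel_sum_iff w assms parallel_difference_form) (simp add: form_le_def)
  moreover have "\<alpha> (\<beta> s) \<le>\<^sub>F s"
    using t closure_le closure_form by (simp add: parallel_sum_mono_left w)
  ultimately show ?thesis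
    by (intro form_le_antisym) (simp_all add: parallel_sum_form w assms parallel_difference_form
        parallel_sums_forms)
qed

lemma antitone_galois_connection_parallel:
  "antitone_galois_connection (forms sc) (\<le>\<^sub>F)\<inverse>\<inverse> (parallel_sums sc w) (\<le>\<^sub>F) \<alpha> \<beta>"
proof -
  \<comment> \<open>By the adjunction \<open>\<beta> r \<le> \<beta> s\<close> means
    \<open>r \<le> \<alpha> (\<beta> s)\<close>, and the right side equals \<open>s\<close>.\<close>
  have mono: "\<beta> r \<le>\<^sub>F \<beta> s"
    if "r \<in> parallel_sums sc w" "s \<in> parallel_sums sc w" "r \<le>\<^sub>F s" for r s
    using that by (simp add: le_parallel_sum_iff[symmetric] w parallel_difference_form
        parallel_sum_parallel_difference)
  have "poset_on (forms sc) (\<le>\<^sub>F)\<inverse>\<inverse>" "poset_on (parallel_sums sc w) (\<le>\<^sub>F)"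
    unfolding poset_on_def
    by (auto intro!: reflp_onI transp_onI antisymp_onI
        intro: form_le_refl form_le_trans form_le_antisym parallel_sums_forms)
  moreover have "monotone_on (forms sc) (\<le>\<^sub>F)\<inverse>\<inverse> (\<le>\<^sub>F)\<inverse>\<inverse> \<alpha>"
    using parallel_sum_mono_left[OF _ _ w] by (simp add: monotone_on_def)
  moreover have "monotone_on (parallel_sums sc w) (\<le>\<^sub>F) (\<le>\<^sub>F)\<inverse>\<inverse>\<inverse>\<inverse> \<beta>"
    using mono by (simp add: monotone_on_def)
  ultimately show ?thesis
    unfolding antitone_galois_connection_def
    by (simp add: parallel_sum_in parallel_difference_form w le_parallel_sum_iff)
qed

section \<open>Dominated forms are closed\<close>

lemma dominated_le_closure:
  assumes "f \<in> dominated sc w"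
  shows "f \<le>\<^sub>F \<beta> (\<alpha> f)"
  unfolding form_le_def
proof (rule allI, rule field_le_epsilon)
  fix x and e :: real
  assume e: "0 < e"
  obtain c where f: "f \<in> forms sc" and c: "0 \<le> c" "\<And>x. quad f x \<le> c * quad w x"
    using assms by (auto simp: dominated_def form_le_def quad_scale_form)
  \<comment> \<open>Adding 1 makes the domination constant strictly positive, so that it can be
    divided out.\<close>
  define K where "K = c + 1"
  have K: "0 < K" using c by (simp add: K_def)
  have fK: "quad f y \<le> K * quad w y" for y
    using c(2)[of y] quad_nonneg[OF w, of y] by (simp add: K_def distrib_right)
  define b where "b y = Re (f x y) + Re (f y x)" for y
  have b_add: "b (y + v) = b y + b v" for y v
    by (simp add: b_def form_add_left[OF f] form_add_right[OF f])
  \<comment> \<open>Completing the square: \<open>f[y - K x] \<ge> 0\<close> together with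
    \<open>f[y] \<le> K w[y]\<close>, divided by \<open>K\<close>. Domination thereby makes the
    infimum of \<open>w[y] - b y\<close> finite.\<close>
  have "- (K * quad f x) \<le> quad w y - b y" for y
  proof -
    have "0 \<le> quad f (y + sc (of_real (- K)) x)" by (rule quad_nonneg[OF f])
    also have "\<dots> = quad f y - K * b y + K\<^sup>2 * quad f x"
      unfolding quad_add_scale[OF f] by (simp add: b_def algebra_simps)
    finally have "0 \<le> K * (quad w y - b y + K * quad f x)"
      using fK[of y] by (simp add: algebra_simps power2_eq_square)
    then show ?thesis using K by (simp add: zero_le_mult_iff)
  qed
  then have bdd: "bdd_below (range (\<lambda>y. quad w y - b y))"
    by (intro bdd_belowI2)
  have "(INF y. quad w y - b y) < (INF y. quad w y - b y) + e" using e by simp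
  then obtain y where y: "quad w y - b y < (INF y. quad w y - b y) + e"
    by (subst (asm) cINF_less_iff[OF _ bdd]) auto
  have "quad f x + quad w y - e \<le> quad (\<alpha> f) (x + y)"
    unfolding le_quad_parallel_sum_iff[OF f w]
  proof
    fix z
    \<comment> \<open>In terms of the deviation \<open>v\<close> from \<open>y\<close>, the
      expansion of \<open>f[x - v]\<close> contributes \<open>- b v\<close>, and near-minimality of
      \<open>y\<close> bounds \<open>w[y + v] - b v\<close> below by
      \<open>w[y] - e\<close>.\<close>
    define v where "v = z - y"
    have "(INF y. quad w y - b y) \<le> quad w z - b z"
      by (rule cINF_lower[OF bdd UNIV_I])
    with y have "quad w y - b y - e \<le> quad w z - (b y + b v)"
      using b_add[of y v] by (simp add: v_def)
    moreover have "quad f (x + y - z) = quad f x - b v + quad f v"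
      using quad_diff[OF f, of x v] by (simp add: v_def b_def algebra_simps)
    ultimately show "quad f x + quad w y - e \<le> quad f (x + y - z) + quad w z"
      using quad_nonneg[OF f, of v] by simp
  qed
  moreover have "quad (\<alpha> f) (x + y) - quad w y \<le> quad (\<beta> (\<alpha> f)) x"
    using quad_parallel_difference_le_iff[OF w parallel_sum_in[OF f]] by blast
  ultimately show "quad f x \<le> quad (\<beta> (\<alpha> f)) x + e" by simp
qed

text \<open>Monotonicity of the closure lifts \<open>f \<le> \<beta> (\<alpha> f)\<close> to any
  form above \<open>f\<close>. It is applied to the approximants \<open>t : n w\<close> and to the
  sequences that define almost domination.\<close>

lemma dominated_le_imp_le_closure:
  assumes "f \<in> dominated sc w" "t \<in> forms sc" "f \<le>\<^sub>F t"
  shows "f \<le>\<^sub>F \<beta> (\<alpha> t)"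
proof -
  have "f \<in> forms sc" using assms by (simp add: dominated_def)
  from closure_mono[OF this assms(2,3)] dominated_le_closure[OF assms(1)] show ?thesis
    by (auto simp: form_le_def intro: order_trans)
qed

section \<open>Convergence of \<open>t : n w\<close> to the closure of \<open>t\<close>\<close>

lemma parallel_sum_scale_dominated:
  assumes "t \<in> forms sc"
  shows "parallel_sum sc t (scale_form (real n) w) \<in> dominated sc w"
  unfolding dominated_def
  using assms parallel_sum_le_right parallel_sum_form scale_form_form[OF _ w, of "real n"]
  by (auto intro!: exI[of _ "real n"])

text \<open>The coefficient is that of the parallel sum of \<open>r w\<close> and \<open>w\<close>.
  After multiplication by \<open>r + 1\<close> the gap between the two sides is exactly
  \<open>w[z - r y] \<ge> 0\<close>.\<close>

lemma quad_harmonic_mean_le: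
  assumes "0 \<le> r"
  shows "r / (r + 1) * quad w (y + z) \<le> r * quad w y + quad w z"
proof -
  have "0 \<le> quad w (z + sc (of_real (- r)) y)" by (rule quad_nonneg[OF w])
  also have "\<dots> = quad w z - r * (Re (w y z) + Re (w z y)) + r\<^sup>2 * quad w y"
    unfolding quad_add_scale[OF w] by (simp add: algebra_simps)
  finally have "r * quad w (y + z) \<le> (r + 1) * (r * quad w y + quad w z)"
    unfolding quad_add[OF w] by (simp add: algebra_simps power2_eq_square)
  then show ?thesis using assms by (simp add: pos_divide_le_eq mult.commute)
qed

text \<open>This is \<open>n / (n + 1) (t : w) \<le> (t : n w) : w\<close> with the outer infimum
  unfolded, so that every \<open>y\<close> gives a lower bound at \<open>x\<close>. It follows by
  splitting \<open>x + y\<close> into \<open>x - z\<close> and \<open>z + y\<close> and spreading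
  \<open>w[z + y]\<close> over \<open>n w[z]\<close> and \<open>w[y]\<close>.\<close>

lemma quad_parallel_sum_scale_ge:
  assumes t: "t \<in> forms sc"
  shows "real n / (real n + 1) * quad (\<alpha> t) (x + y) - quad w y
    \<le> quad (parallel_sum sc t (scale_form (real n) w)) x"
proof -
  let ?r = "real n / (real n + 1)"
  have "?r * quad (\<alpha> t) (x + y) - quad w y \<le> quad t (x - z) + real n * quad w z" for z
  proof -
    have "quad (\<alpha> t) (x + y) \<le> quad t (x - z) + quad w (z + y)"
      using quad_parallel_sum_add_le[OF t w, of "x - z" "z + y"] by simp
    then have "?r * quad (\<alpha> t) (x + y) \<le> ?r * quad t (x - z) + ?r * quad w (z + y)"
      unfolding distrib_left[symmetric] by (rule mult_left_mono) simp
    also have "\<dots> \<le> quad t (x - z) + (real n * quad w z + quad w y)"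
      using quad_nonneg[OF t, of "x - z"] quad_harmonic_mean_le[of "real n" z y]
      by (intro add_mono mult_left_le_one_le) auto
    finally show ?thesis by simp
  qed
  then show ?thesis
    by (simp add: le_quad_parallel_sum_iff t w scale_form_form quad_scale_form)
qed

text \<open>From below, each term of the supremum defining \<open>\<beta> (\<alpha> t)\<close> is
  approached because \<open>n / (n + 1)\<close> tends to 1. From above, \<open>t : n w\<close> is a
  dominated form below \<open>t\<close>, hence below the closure of \<open>t\<close>.\<close>

lemma quad_parallel_sum_scale_tendsto:
  assumes t: "t \<in> forms sc"
  shows "(\<lambda>n. quad (parallel_sum sc t (scale_form (real n) w)) x) \<longlonglongrightarrow> quad (\<beta> (\<alpha> t)) x"
proof (rule order_tendstoI)
  fix a
  assume "a < quad (\<beta> (\<alpha> t)) x"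
  then obtain y where y: "a < quad (\<alpha> t) (x + y) - quad w y"
    using quad_parallel_difference_le_iff[OF w parallel_sum_in[OF t]]
    by (meson linorder_not_less)
  have "(\<lambda>n. real n / (real n + 1) * quad (\<alpha> t) (x + y) - quad w y)
      \<longlonglongrightarrow> 1 * quad (\<alpha> t) (x + y) - quad w y"
    using LIMSEQ_n_over_Suc_n by (intro tendsto_intros) (simp add: add.commute)
  with y have "\<forall>\<^sub>F n in sequentially. a < real n / (real n + 1) * quad (\<alpha> t) (x + y) - quad w y"
    by (simp add: order_tendstoD(1))
  then show "\<forall>\<^sub>F n in sequentially. a < quad (parallel_sum sc t (scale_form (real n) w)) x"
    by eventually_elim (rule less_le_trans[OF _ quad_parallel_sum_scale_ge[OF t]])
next
  fix a
  assume a: "quad (\<beta> (\<alpha> t)) x < a"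
  have "parallel_sum sc t (scale_form (real n) w) \<le>\<^sub>F \<beta> (\<alpha> t)" for n
    by (intro dominated_le_imp_le_closure parallel_sum_scale_dominated parallel_sum_le_left
        scale_form_form t w) simp
  with a show "\<forall>\<^sub>F n in sequentially. quad (parallel_sum sc t (scale_form (real n) w)) x < a"
    by (auto simp: form_le_def intro: le_less_trans always_eventually)
qed

section \<open>Closed forms, almost dominated forms and \<open>D_part\<close>\<close>

lemma D_part_eq_closure:
  assumes "t \<in> forms sc"
  shows "D_part sc w t = \<beta> (\<alpha> t)"
  unfolding D_part_def
proof (rule the_equality)
  fix d
  assume "d \<in> forms sc \<and>
    (\<forall>x. (\<lambda>n. quad (parallel_sum sc t (scale_form (real n) w)) x) \<longlonglongrightarrow> quad d x)"
  then show "d = \<beta> (\<alpha> t)"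
    using quad_parallel_sum_scale_tendsto[OF assms] closure_form[OF assms]
    by (blast intro: form_eqI LIMSEQ_unique)
qed (simp add: assms closure_form quad_parallel_sum_scale_tendsto)

text \<open>A closed \<open>t\<close> is the pointwise limit of the dominated forms
  \<open>t : n w\<close>, all below \<open>t\<close>, hence their supremum. Conversely, the closure
  of \<open>t\<close> bounds every dominated form below \<open>t\<close>, so leastness of the
  supremum gives \<open>t \<le> \<beta> (\<alpha> t)\<close>.\<close>

lemma closed_eq_almost_dominated: "{t \<in> forms sc. \<beta> (\<alpha> t) = t} = almost_dominated sc w"
proof (intro equalityI subsetI)
  fix t
  assume "t \<in> {t \<in> forms sc. \<beta> (\<alpha> t) = t}"
  then have t: "t \<in> forms sc" and closed: "\<beta> (\<alpha> t) = t" by auto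
  let ?f = "\<lambda>n. parallel_sum sc t (scale_form (real n) w)"
  have "t \<le>\<^sub>F u" if "\<forall>n. ?f n \<le>\<^sub>F u" for u
    unfolding form_le_def
  proof
    fix x
    show "quad t x \<le> quad u x"
      using quad_parallel_sum_scale_tendsto[OF t, of x] that
      unfolding closed form_le_def by (intro LIMSEQ_le_const2) auto
  qed
  moreover have "?f n \<le>\<^sub>F t" for n
    by (simp add: parallel_sum_le_left t w scale_form_form)
  ultimately have "is_form_supremum sc (range ?f) t"
    by (simp add: is_form_supremum_def t)
  with t parallel_sum_scale_dominated[OF t] show "t \<in> almost_dominated sc w"
    unfolding almost_dominated_def by (intro CollectI conjI exI[of _ ?f]) auto
next
  fix t
  assume "t \<in> almost_dominated sc w"
  then obtain f :: "nat \<Rightarrow> 'a \<Rightarrow> 'a \<Rightarrow> complex"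
    where t: "t \<in> forms sc" and f: "\<And>n. f n \<in> dominated sc w"
      and sup: "is_form_supremum sc (range f) t"
    by (auto simp: almost_dominated_def)
  have "f n \<le>\<^sub>F \<beta> (\<alpha> t)" for n
    using sup f t by (intro dominated_le_imp_le_closure) (auto simp: is_form_supremum_def)
  then have "t \<le>\<^sub>F \<beta> (\<alpha> t)"
    using sup closure_form[OF t] by (auto simp: is_form_supremum_def)
  with t show "t \<in> {t \<in> forms sc. \<beta> (\<alpha> t) = t}"
    by (simp add: form_le_antisym closure_form closure_le)
qed

lemma D_parts_eq: "{D_part sc w t | t. t \<in> forms sc} = \<beta> ` parallel_sums sc w"
  using D_part_eq_closure by (auto simp: parallel_sums_def image_iff) metis

end

theorem theorem11:
  fixes sc :: "complex \<Rightarrow> 'a::ab_group_add \<Rightarrow> 'a"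
    and w :: "'a \<Rightarrow> 'a \<Rightarrow> complex"
  assumes "vector_space sc"
    and "w \<in> forms sc"
  shows "let \<alpha> = (\<lambda>t. parallel_sum sc t w);
             \<beta> = (\<lambda>s. parallel_difference sc s w)
         in parallel_sums sc w \<subseteq> forms sc \<and>
            antitone_galois_connection (forms sc) (\<le>\<^sub>F)\<inverse>\<inverse> (parallel_sums sc w) (\<le>\<^sub>F) \<alpha> \<beta> \<and>
            {t \<in> forms sc. \<beta> (\<alpha> t) = t} = almost_dominated sc w \<and>
            bij_betw \<alpha> {D_part sc w t | t. t \<in> forms sc}
                       {parallel_sum sc t w | t. t \<in> forms sc} \<and>
            (\<forall>s\<in>parallel_sums sc w.
               inv_into {D_part sc w t | t. t \<in> forms sc} \<alpha> s = \<beta> s)"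
proof -
  interpret form_space sc w
    using assms by (simp add: form_space_def complex_linear_space_def form_space_axioms_def)
  \<comment> \<open>With the domain rewritten as the image of \<open>\<beta>\<close>, the single
    identity \<open>\<alpha> (\<beta> s) = s\<close> yields both inverse laws.\<close>
  have bij: "bij_betw (\<lambda>t. parallel_sum sc t w) {D_part sc w t | t. t \<in> forms sc}
      (parallel_sums sc w)"
    unfolding D_parts_eq
    by (rule bij_betw_byWitness[where f' = "\<lambda>s. parallel_difference sc s w"])
      (auto simp: parallel_sum_parallel_difference)
  moreover have "inv_into {D_part sc w t | t. t \<in> forms sc} (\<lambda>t. parallel_sum sc t w) s
      = parallel_difference sc s w" if "s \<in> parallel_sums sc w" for s
    using that bij unfolding D_parts_eq
    by (intro inv_into_f_eq) (auto simp: bij_betw_def parallel_sum_parallel_difference)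
  ultimately show ?thesis
    using antitone_galois_connection_parallel closed_eq_almost_dominated parallel_sums_forms
    unfolding Let_def parallel_sums_def[symmetric] by blast
qed

end
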